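(* Let $n\geq 1$, let $M$ be a real $n\times n$ matrix, and let $q\in\mathbb{R}^n$. Define $F:\mathbb{R}^n\to\mathbb{R}^n$ by $$F(x):=(M+I)x+(M-I)|x|+q,$$ and for each integer $p\geq 1$ define $\tilde F(p,\cdot):\mathbb{R}^n\to\mathbb{R}^n$ by $$\tilde F(p,x):=(M+I)x+\frac{1}{p}(M-I)\ln\left(e^{0}+e^{px}+e^{-px}\right)+q.$$ Then $\tilde F(p,\cdot)$ converges to $F$ uniformly on $\mathbb{R}^n$ as $p\to+\infty$.
   Context: $I$ is the $n\times n$ identity matrix and $\|\cdot\|$ is the Euclidean norm on $\mathbb{R}^n$. Absolute value, exponential and logarithm of vectors are taken componentwise: for $x\in\mathbb{R}^n$, $|x|=(|x_1|,\dots,|x_n|)^T$ and $e^{x}=(e^{x_1},\dots,e^{x_n})^T$ (so $e^0=(1,\dots,1)^T$ when $0$ is the zero vector), and for $x\in\mathbb{R}^n$ with all $x_i>0$, $\ln(x)=(\ln x_1,\dots,\ln x_n)^T$. Thus the $i$-th component of $\ln(e^{0}+e^{px}+e^{-px})$ is $\ln(1+e^{px_i}+e^{-px_i})$. *)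

theory Defs
  imports "HOL-Analysis.Analysis"
begin

definition vec_exp :: "real ^ 'n \<Rightarrow> real ^ 'n" where
  "vec_exp x = (\<chi> i. exp (x $ i))"

(* Only meaningful for vectors with positive entries, as ln is on the reals. *)
definition vec_ln :: "real ^ 'n \<Rightarrow> real ^ 'n" where
  "vec_ln x = (\<chi> i. ln (x $ i))"

(* The absolute value on real ^ 'n is the library's componentwise one (abs_vec_def). *)
definition F :: "real ^ 'n ^ 'n \<Rightarrow> real ^ 'n \<Rightarrow> real ^ 'n \<Rightarrow> real ^ 'n" where
  "F M q x = (M + mat 1) *v x + (M - mat 1) *v \<bar>x\<bar> + q"

definition F_tilde :: "real ^ 'n ^ 'n \<Rightarrow> real ^ 'n \<Rightarrow> nat \<Rightarrow> real ^ 'n \<Rightarrow> real ^ 'n" where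
  "F_tilde M q p x =
     (M + mat 1) *v x
     + (1 / real p) *\<^sub>R ((M - mat 1) *v
         vec_ln (vec_exp 0 + vec_exp (real p *\<^sub>R x) + vec_exp (- (real p *\<^sub>R x))))
     + q"

end

theory Submission
  imports Defs
begin

text \<open>
  Since the largest of the three terms in \<open>1 + exp (p * t) + exp (- (p * t))\<close> is \<open>exp (p * \<bar>t\<bar>)\<close>,
  the sum lies between \<open>exp (p * \<bar>t\<bar>)\<close> and \<open>3 * exp (p * \<bar>t\<bar>)\<close>. So the smoothed absolute value
  differs from \<open>\<bar>t\<bar>\<close> by at most \<open>ln 3 / p\<close>, and linear maps preserve uniform convergence.
\<close>

lemma smooth_abs_error:
  fixes p t :: real
  assumes "p > 0"
  shows "\<bar>ln (1 + exp (p * t) + exp (- (p * t))) / p - \<bar>t\<bar>\<bar> \<le> ln 3 / p"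
proof -
  let ?s = "1 + exp (p * t) + exp (- (p * t))"
  let ?m = "p * \<bar>t\<bar>"
  have pos: "?s > 0"
    by (intro add_pos_pos) auto
  have m: "?m = \<bar>p * t\<bar>"
    using assms by (simp add: abs_mult)
  \<comment> \<open>\<open>exp ?m\<close> is itself a summand of \<open>?s\<close>; the sign of
    \<open>p * t\<close> decides which one.\<close>
  have "exp ?m \<le> ?s"
    by (cases "p * t \<ge> 0") (simp_all add: m add_increasing)
  then have lower: "?m \<le> ln ?s"
    using pos by (simp add: ln_ge_iff)
  have "1 \<le> exp ?m" "exp (p * t) \<le> exp ?m" "exp (- (p * t)) \<le> exp ?m"
    by (simp_all add: m)
  then have "?s \<le> 3 * exp ?m"
    by linarith
  then have "ln ?s \<le> ln (3 * exp ?m)"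
    using pos by simp
  also have "\<dots> = ln 3 + ?m"
    by (simp add: ln_mult)
  finally have upper: "ln ?s \<le> ln 3 + ?m" .
  have "ln ?s / p - \<bar>t\<bar> = (ln ?s - ?m) / p"
    using assms by (simp add: diff_divide_distrib)
  then show ?thesis
    using lower upper assms by (simp add: divide_right_mono)
qed

lemma uniform_limit_smooth_abs:
  "uniform_limit UNIV
     (\<lambda>p x :: real ^ 'n. (1 / real p) *\<^sub>R
        vec_ln (vec_exp 0 + vec_exp (real p *\<^sub>R x) + vec_exp (- (real p *\<^sub>R x))))
     abs sequentially"
  (is "uniform_limit _ ?G _ _")
proof (rule uniform_limitI)
  fix e :: real
  assume "e > 0"
  \<comment> \<open>At \<open>p = 0\<close> division by zero makes both \<open>?G p x\<close> and
    the right side vanish, so the bound would fail for nonzero \<open>x\<close>.\<close>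
  have bound: "norm (?G p x - \<bar>x\<bar>) \<le> real CARD('n) * ln 3 / real p" if "p > 0" for p x
  proof -
    \<comment> \<open>Passing to the l1 norm leaves one scalar error per coordinate, each bounded
      independently of \<open>x\<close>; this costs the factor \<open>CARD('n)\<close>.\<close>
    have "norm (?G p x - \<bar>x\<bar>) \<le> (\<Sum>i\<in>UNIV. \<bar>(?G p x - \<bar>x\<bar>) $ i\<bar>)"
      by (rule norm_le_l1_cart)
    also have "\<dots> \<le> (\<Sum>i\<in>(UNIV :: 'n set). ln 3 / real p)"
      using smooth_abs_error[of "real p"] that
      by (intro sum_mono) (simp add: vec_ln_def vec_exp_def abs_vec_def)
    finally show ?thesis
      by simp
  qed
  have "(\<lambda>p. real CARD('n) * ln 3 / real p) \<longlonglongrightarrow> 0"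
    by (rule lim_const_over_n)
  then have "\<forall>\<^sub>F p in sequentially. real CARD('n) * ln 3 / real p < e"
    using \<open>e > 0\<close> by (rule order_tendstoD)
  then show "\<forall>\<^sub>F p in sequentially. \<forall>x\<in>UNIV. dist (?G p x) \<bar>x\<bar> < e"
    using eventually_gt_at_top[of 0]
  proof eventually_elim
    case (elim p)
    then show ?case
      using bound[of p] by (auto simp only: dist_norm intro: le_less_trans)
  qed
qed

theorem proposition1:
  fixes M :: "real ^ 'n ^ 'n" and q :: "real ^ 'n"
  shows "uniform_limit UNIV (\<lambda>p. F_tilde M q p) (F M q) sequentially"
proof -
  \<comment> \<open>With \<open>1 / real p\<close> inside the product, a fixed linear map acts on
    the convergent family; \<open>matrix_vector_mult_scaleR\<close> then moves the factor
    out.\<close>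
  have "uniform_limit UNIV
      (\<lambda>p x. (M + mat 1) *v x + (M - mat 1) *v ((1 / real p) *\<^sub>R
         vec_ln (vec_exp 0 + vec_exp (real p *\<^sub>R x) + vec_exp (- (real p *\<^sub>R x)))) + q)
      (\<lambda>x. (M + mat 1) *v x + (M - mat 1) *v \<bar>x\<bar> + q) sequentially"
    by (intro uniform_limit_add uniform_limit_const
        bounded_linear.uniform_limit[OF matrix_vector_mul_bounded_linear uniform_limit_smooth_abs])
  then show ?thesis
    by (simp only: F_tilde_def[abs_def] F_def[abs_def] matrix_vector_mult_scaleR)
qed

end
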